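(* Let $T\in \mathcal{B}_A(\mathcal{H})$. Then $$d\omega_A(T) \leq \sqrt{\max\{\|T\|_A^2, \|T\|_A^4\} + \omega_A(T^\sharp T^2)}.$$
   Context: $\mathcal{H}$ is a complex Hilbert space with inner product $\langle\cdot\mid\cdot\rangle$, $\mathcal{B}(\mathcal{H})$ is the algebra of bounded linear operators on $\mathcal{H}$, and $A\in\mathcal{B}(\mathcal{H})$ is a fixed nonzero positive (semidefinite) operator. Put $\langle x\mid y\rangle_A=\langle Ax\mid y\rangle$ and $\|x\|_A=\langle x\mid x\rangle_A^{1/2}$. $\mathcal{B}_A(\mathcal{H})=\{T\in\mathcal{B}(\mathcal{H}) : \mathcal{R}(T^*A)\subseteq\mathcal{R}(A)\}$, where $\mathcal{R}$ denotes range; for $T\in\mathcal{B}_A(\mathcal{H})$, $T^\sharp$ denotes the unique $X\in\mathcal{B}(\mathcal{H})$ with $AX=T^*A$ and $\mathcal{R}(X)\subseteq\overline{\mathcal{R}(A)}$ (so $\langle Tx\mid y\rangle_A=\langle x\mid T^\sharp y\rangle_A$); $T^\sharp T^2$ means the product $T^\sharp\cdot T\cdot T$. For $T\in\mathcal{B}_A(\mathcal{H})$: $\|T\|_A=\sup\{\|Tx\|_A : \|x\|_A=1\}$, $\omega_A(T)=\sup\{|\langle Tx\mid x\rangle_A| : \|x\|_A=1\}$, and the $A$-Davis-Wielandt radius is $d\omega_A(T)=\sup\{\sqrt{|\langle Tx\mid x\rangle_A|^2+\|Tx\|_A^4} : \|x\|_A=1\}$. All of these are finite. *)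

theory Defs
  imports "HOL-Analysis.Analysis"
begin

class complex_vector = real_vector +
  fixes scaleC :: "complex \<Rightarrow> 'a \<Rightarrow> 'a" (infixr "*\<^sub>C" 75)
  assumes scaleC_add_right: "c *\<^sub>C (x + y) = c *\<^sub>C x + c *\<^sub>C y"
    and scaleC_add_left: "(c + d) *\<^sub>C x = c *\<^sub>C x + d *\<^sub>C x"
    and scaleC_scaleC: "c *\<^sub>C (d *\<^sub>C x) = (c * d) *\<^sub>C x"
    and scaleC_one: "1 *\<^sub>C x = x"
    and scaleR_scaleC: "r *\<^sub>R x = complex_of_real r *\<^sub>C x"

text \<open>The inner product is linear in its first argument and conjugate-linear in its second one.
  Completeness comes from the superclass \<^class>\<open>banach\<close>.\<close>

class chilbert_space = complex_vector + banach +
  fixes cinner :: "'a \<Rightarrow> 'a \<Rightarrow> complex"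
  assumes cinner_commute: "cinner x y = cnj (cinner y x)"
    and cinner_add_left: "cinner (x + y) z = cinner x z + cinner y z"
    and cinner_scaleC_left: "cinner (c *\<^sub>C x) y = c * cinner x y"
    and cinner_self_nonneg: "cinner x x \<in> \<real>\<^sub>\<ge>\<^sub>0"
    and cinner_eq_zero_iff: "cinner x x = 0 \<longleftrightarrow> x = 0"
    and norm_eq_sqrt_cinner: "norm x = sqrt (Re (cinner x x))"

instantiation complex :: chilbert_space
begin

definition scaleC_complex :: "complex \<Rightarrow> complex \<Rightarrow> complex"
  where "scaleC_complex c x = c * x"

definition cinner_complex :: "complex \<Rightarrow> complex \<Rightarrow> complex"
  where "cinner_complex x y = x * cnj y"

instance
  by standard
    (auto simp: scaleC_complex_def cinner_complex_def algebra_simps scaleR_conv_of_real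
      complex_nonneg_Reals_iff cmod_def power2_eq_square)

end

definition bounded_ops :: "('a::chilbert_space \<Rightarrow> 'a) set"
  where "bounded_ops = {T. bounded_linear T \<and> (\<forall>c x. T (c *\<^sub>C x) = c *\<^sub>C T x)}"

definition positive_op :: "('a::chilbert_space \<Rightarrow> 'a) \<Rightarrow> bool"
  where "positive_op A \<longleftrightarrow> A \<in> bounded_ops \<and> (\<forall>x. cinner (A x) x \<in> \<real>\<^sub>\<ge>\<^sub>0)"

text \<open>For bounded \<open>T\<close> existence and uniqueness follow from the Riesz representation theorem.\<close>

definition adjoint_op :: "('a::chilbert_space \<Rightarrow> 'a) \<Rightarrow> 'a \<Rightarrow> 'a"
  where "adjoint_op T = (THE S. S \<in> bounded_ops \<and> (\<forall>x y. cinner (T x) y = cinner x (S y)))"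

definition A_inner :: "('a::chilbert_space \<Rightarrow> 'a) \<Rightarrow> 'a \<Rightarrow> 'a \<Rightarrow> complex"
  where "A_inner A x y = cinner (A x) y"

text \<open>For positive \<open>A\<close> the number \<open>A_inner A x x\<close> is real and nonnegative.\<close>

definition A_norm :: "('a::chilbert_space \<Rightarrow> 'a) \<Rightarrow> 'a \<Rightarrow> real"
  where "A_norm A x = sqrt (Re (A_inner A x x))"

definition A_adjointable :: "('a::chilbert_space \<Rightarrow> 'a) \<Rightarrow> ('a \<Rightarrow> 'a) set"
  where "A_adjointable A = {T \<in> bounded_ops. range (adjoint_op T \<circ> A) \<subseteq> range A}"

text \<open>The reduced solution of \<open>A X = T\<^sup>* A\<close>; for positive \<open>A\<close> and \<open>T \<in> A_adjointable A\<close> it exists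
  and is unique by Douglas' theorem.\<close>

definition A_adjoint :: "('a::chilbert_space \<Rightarrow> 'a) \<Rightarrow> ('a \<Rightarrow> 'a) \<Rightarrow> 'a \<Rightarrow> 'a"
  where "A_adjoint A T =
    (THE X. X \<in> bounded_ops \<and> A \<circ> X = adjoint_op T \<circ> A \<and> range X \<subseteq> closure (range A))"

text \<open>For positive \<open>A \<noteq> 0\<close> and \<open>T \<in> A_adjointable A\<close> the sets below are nonempty and bounded above,
  so that \<^const>\<open>Sup\<close> on the reals is the genuine supremum.\<close>

definition A_op_norm :: "('a::chilbert_space \<Rightarrow> 'a) \<Rightarrow> ('a \<Rightarrow> 'a) \<Rightarrow> real"
  where "A_op_norm A T = Sup {A_norm A (T x) | x. A_norm A x = 1}"

definition A_numerical_radius :: "('a::chilbert_space \<Rightarrow> 'a) \<Rightarrow> ('a \<Rightarrow> 'a) \<Rightarrow> real"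
  where "A_numerical_radius A T = Sup {cmod (A_inner A (T x) x) | x. A_norm A x = 1}"

definition A_Davis_Wielandt_radius :: "('a::chilbert_space \<Rightarrow> 'a) \<Rightarrow> ('a \<Rightarrow> 'a) \<Rightarrow> real"
  where "A_Davis_Wielandt_radius A T =
    Sup {sqrt ((cmod (A_inner A (T x) x))\<^sup>2 + A_norm A (T x) ^ 4) | x. A_norm A x = 1}"

end

theory Submission
  imports Defs
begin

text \<open>
  Apply Bombieri's inequality
  \<open>|\<langle>u, a\<rangle>|\<^sup>2 + |\<langle>u, b\<rangle>|\<^sup>2 \<le> \<parallel>u\<parallel>\<^sup>2 (max \<parallel>a\<parallel>\<^sup>2 \<parallel>b\<parallel>\<^sup>2 + |\<langle>a, b\<rangle>|)\<close>
  in the semi-inner product of \<open>A\<close> to a unit vector \<open>u = x\<close>, \<open>a = T x\<close> and \<open>b = X (T x)\<close>,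
  where \<open>X\<close> is the \<open>A\<close>-adjoint of \<open>T\<close>: then \<open>\<langle>x, b\<rangle> = \<parallel>T x\<parallel>\<^sup>2\<close> and
  \<open>\<langle>a, b\<rangle> = \<langle>X (T (T x)), x\<rangle>\<close>. Existence of \<open>X\<close> is Douglas' theorem, obtained from orthogonal
  projections and the uniform boundedness principle; \<open>A\<close>-boundedness of \<open>T\<close>, needed for the
  suprema to be genuine, follows from Krein's theorem on the symmetrizable operator \<open>X \<circ> T\<close>.
\<close>

section \<open>Positive semidefinite sesquilinear forms\<close>

locale semi_inner =
  fixes B :: "'a::complex_vector \<Rightarrow> 'a \<Rightarrow> complex"
  assumes commute: "B x y = cnj (B y x)"
    and add_left: "B (x + y) z = B x z + B y z"
    and scaleC_left: "B (c *\<^sub>C x) y = c * B x y"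
    and self_nonneg: "B x x \<in> \<real>\<^sub>\<ge>\<^sub>0"
begin

definition seminorm :: "'a \<Rightarrow> real"
  where "seminorm x = sqrt (Re (B x x))"

lemma add_right: "B x (y + z) = B x y + B x z"
  by (metis add_left commute complex_cnj_add)

lemma scaleC_right: "B x (c *\<^sub>C y) = cnj c * B x y"
  by (metis commute complex_cnj_mult scaleC_left)

lemma Re_self_nonneg: "Re (B x x) \<ge> 0"
  using self_nonneg[of x] by (simp add: complex_nonneg_Reals_iff)

lemma seminorm_nonneg: "seminorm x \<ge> 0"
  by (simp add: seminorm_def Re_self_nonneg)

lemma seminorm_power2: "(seminorm x)\<^sup>2 = Re (B x x)"
  by (simp add: seminorm_def Re_self_nonneg)

lemma self_eq: "B x x = complex_of_real ((seminorm x)\<^sup>2)"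
  using self_nonneg[of x] by (simp add: seminorm_power2 complex_nonneg_Reals_iff complex_eq_iff)

lemma seminorm_scaleC: "seminorm (c *\<^sub>C x) = cmod c * seminorm x"
proof -
  have "B (c *\<^sub>C x) (c *\<^sub>C x) = complex_of_real ((cmod c)\<^sup>2) * B x x"
    by (simp only: complex_norm_square) (simp add: scaleC_left scaleC_right)
  then have "(seminorm (c *\<^sub>C x))\<^sup>2 = (cmod c * seminorm x)\<^sup>2"
    by (simp add: seminorm_power2 power_mult_distrib)
  then show ?thesis
    by (simp add: seminorm_nonneg)
qed

text \<open>The form may be degenerate, so \<open>y\<close> cannot be normalized. Nonnegativity of
  the form at \<open>x + c *\<^sub>C y\<close> yields a quadratic inequality in a real parameter
  \<open>t\<close>, and a suitable \<open>t\<close> is inserted.\<close>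

lemma Cauchy_Schwarz: "cmod (B x y) \<le> seminorm x * seminorm y"
proof -
  define k where "k = (cmod (B x y))\<^sup>2"
  define b where "b = Re (B y y)"
  define a where "a = Re (B x x)"
  have ge: "0 \<le> a - 2 * t * k + t\<^sup>2 * k * b" for t
  proof -
    \<comment> \<open>The factor \<open>B x y\<close> aligns the phases, so the two cross terms add
      up to the real number \<open>- 2 * t * k\<close>.\<close>
    define c where "c = - (complex_of_real t * B x y)"
    have "B (x + c *\<^sub>C y) (x + c *\<^sub>C y)
        = B x x + cnj c * B x y + c * cnj (B x y) + c * cnj c * B y y"
      using commute[of y x] by (simp add: add_left add_right scaleC_left scaleC_right algebra_simps)
    also have "\<dots> = B x x - 2 * complex_of_real t * (B x y * cnj (B x y))
        + (complex_of_real t)\<^sup>2 * (B x y * cnj (B x y)) * B y y"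
      by (simp add: c_def algebra_simps power2_eq_square)
    also have "\<dots> = B x x - complex_of_real (2 * t * k) + complex_of_real (t\<^sup>2 * k) * B y y"
      by (simp add: k_def complex_norm_square flip: of_real_power)
    finally have "Re (B (x + c *\<^sub>C y) (x + c *\<^sub>C y)) = a - 2 * t * k + t\<^sup>2 * k * b"
      by (simp add: a_def b_def)
    then show ?thesis
      using Re_self_nonneg by metis
  qed
  have "b \<ge> 0" "k \<ge> 0" "a \<ge> 0"
    by (auto simp: b_def k_def a_def Re_self_nonneg)
  have "k \<le> a * b"
  proof (cases "b = 0")
    case True
    \<comment> \<open>The inequality is now affine in \<open>t\<close>; at the chosen
      \<open>t\<close> its right-hand side is \<open>- 1\<close> unless
      \<open>k = 0\<close>.\<close>
    then have "k = 0"
      using ge[of "(a + 1) / (2 * k)"] by (cases "k = 0") (auto simp: field_simps)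
    then show ?thesis
      using True by simp
  next
    case False
    \<comment> \<open>The quadratic is minimal at \<open>t = 1 / b\<close>.\<close>
    then show ?thesis
      using ge[of "1 / b"] \<open>b \<ge> 0\<close> by (simp add: field_simps power2_eq_square)
  qed
  then have "(cmod (B x y))\<^sup>2 \<le> (seminorm x * seminorm y)\<^sup>2"
    by (simp add: k_def a_def b_def seminorm_power2 power_mult_distrib)
  then show ?thesis
    by (rule power2_le_imp_le) (simp add: seminorm_nonneg)
qed

text \<open>Apply Cauchy--Schwarz to \<open>u\<close> and \<open>B u a *\<^sub>C a + B u b *\<^sub>C b\<close>, whose form value is the left-hand side.\<close>

lemma Bombieri_two:
  "(cmod (B u a))\<^sup>2 + (cmod (B u b))\<^sup>2
    \<le> (seminorm u)\<^sup>2 * (max ((seminorm a)\<^sup>2) ((seminorm b)\<^sup>2) + cmod (B a b))"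
proof -
  define p q where "p = B u a" and "q = B u b"
  define v where "v = p *\<^sub>C a + q *\<^sub>C b"
  define L where "L = (cmod p)\<^sup>2 + (cmod q)\<^sup>2"
  define m where "m = max ((seminorm a)\<^sup>2) ((seminorm b)\<^sup>2)"
  have "L \<ge> 0"
    by (simp add: L_def)
  have "B u v = p * cnj p + q * cnj q"
    by (simp add: v_def add_right scaleC_right p_def q_def)
  also have "\<dots> = complex_of_real L"
    by (simp add: L_def flip: complex_norm_square)
  finally have "L \<le> seminorm u * seminorm v"
    using Cauchy_Schwarz[of u v] \<open>L \<ge> 0\<close> by simp
  then have "L\<^sup>2 \<le> (seminorm u)\<^sup>2 * (seminorm v)\<^sup>2"
    using power_mono[OF _ \<open>L \<ge> 0\<close>] by (simp flip: power_mult_distrib)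
  also have "(seminorm v)\<^sup>2 \<le> L * (m + cmod (B a b))"
  proof -
    define z where "z = p * cnj q * B a b"
    have "B v v = p * cnj p * B a a + q * cnj q * B b b + (z + cnj z)"
      using commute[of b a]
      by (simp add: v_def z_def add_left add_right scaleC_left scaleC_right algebra_simps)
    also have "\<dots> = complex_of_real ((cmod p)\<^sup>2 * (seminorm a)\<^sup>2 + (cmod q)\<^sup>2 * (seminorm b)\<^sup>2 + 2 * Re z)"
      unfolding complex_add_cnj by (simp add: self_eq flip: complex_norm_square)
    finally have "(seminorm v)\<^sup>2
        = (cmod p)\<^sup>2 * (seminorm a)\<^sup>2 + (cmod q)\<^sup>2 * (seminorm b)\<^sup>2 + 2 * Re z"
      by (simp add: seminorm_power2)
    moreover have "(cmod p)\<^sup>2 * (seminorm a)\<^sup>2 \<le> (cmod p)\<^sup>2 * m"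
      "(cmod q)\<^sup>2 * (seminorm b)\<^sup>2 \<le> (cmod q)\<^sup>2 * m"
      by (auto simp: m_def intro!: mult_left_mono)
    \<comment> \<open>The inequality between arithmetic and geometric mean replaces
      \<open>2 * cmod p * cmod q\<close> by \<open>L\<close>.\<close>
    moreover have "2 * Re z \<le> L * cmod (B a b)"
    proof -
      have "Re z \<le> cmod p * cmod q * cmod (B a b)"
        using complex_Re_le_cmod[of z] by (simp add: z_def norm_mult)
      moreover have "2 * cmod p * cmod q * cmod (B a b) \<le> L * cmod (B a b)"
        using sum_squares_bound[of "cmod p" "cmod q"] by (intro mult_right_mono) (auto simp: L_def)
      ultimately show ?thesis
        by simp
    qed
    ultimately show ?thesis
      by (simp add: L_def algebra_simps)
  qed
  finally have "L\<^sup>2 \<le> (seminorm u)\<^sup>2 * (L * (m + cmod (B a b)))"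
    by (simp add: mult_left_mono)
  then have "L * L \<le> L * ((seminorm u)\<^sup>2 * (m + cmod (B a b)))"
    by (simp add: power2_eq_square algebra_simps)
  moreover have "m \<ge> 0"
    by (simp add: m_def le_max_iff_disj)
  \<comment> \<open>One factor \<open>L\<close> cancels if \<open>L > 0\<close>; if
    \<open>L = 0\<close> the right-hand side is nonnegative anyway.\<close>
  ultimately have "L \<le> (seminorm u)\<^sup>2 * (m + cmod (B a b))"
    using \<open>L \<ge> 0\<close> by (cases "L = 0") (auto simp: mult_le_cancel_left)
  then show ?thesis
    by (simp add: L_def m_def p_def q_def)
qed

text \<open>Krein's argument: by symmetry of \<open>S\<close> and Cauchy--Schwarz, an initial growth
  factor \<open>r\<close> persists as growth \<open>r ^ 2 ^ n\<close> of the iterates \<open>S ^^ 2 ^ n\<close>.\<close>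

lemma symmetric_seminorm_le:
  assumes sym: "\<And>x y. B (S x) y = B x (S y)"
    and growth: "\<And>n. seminorm ((S ^^ n) x) \<le> C * L ^ n"
    and "L \<ge> 0"
  shows "seminorm (S x) \<le> L * seminorm x"
proof -
  have sym_pow: "B ((S ^^ n) x) y = B x ((S ^^ n) y)" for n x y
    by (induction n arbitrary: x y) (simp_all add: sym funpow_swap1)
  \<comment> \<open>Half of the \<open>2 * n\<close> factors come from moving \<open>S ^^ n\<close>
    across the form; Cauchy-Schwarz does the rest.\<close>
  have sq: "(seminorm ((S ^^ n) x))\<^sup>2 \<le> seminorm x * seminorm ((S ^^ (2 * n)) x)" for n
  proof -
    have "(seminorm ((S ^^ n) x))\<^sup>2 = Re (B x ((S ^^ (2 * n)) x))"
      by (simp add: seminorm_power2 sym_pow mult_2 funpow_add)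
    also have "\<dots> \<le> cmod (B x ((S ^^ (2 * n)) x))"
      by (rule complex_Re_le_cmod)
    also have "\<dots> \<le> seminorm x * seminorm ((S ^^ (2 * n)) x)"
      by (rule Cauchy_Schwarz)
    finally show ?thesis .
  qed
  show ?thesis
  proof (cases "seminorm x = 0")
    case True
    then show ?thesis
      using sq[of 1] by simp
  next
    case False
    define s where "s = seminorm x"
    have "s > 0"
      using False seminorm_nonneg[of x] by (simp add: s_def)
    define r where "r = seminorm (S x) / s"
    have "r \<ge> 0"
      using \<open>s > 0\<close> by (simp add: r_def seminorm_nonneg)
    have iter: "r ^ (2 ^ n) * s \<le> seminorm ((S ^^ (2 ^ n)) x)" for n
    proof (induction n)
      case 0
      then show ?case
        using \<open>s > 0\<close> by (simp add: r_def)
    next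
      case (Suc n)
      have "(r ^ (2 ^ n) * s)\<^sup>2 \<le> (seminorm ((S ^^ (2 ^ n)) x))\<^sup>2"
        using Suc \<open>r \<ge> 0\<close> \<open>s > 0\<close> by (intro power_mono) auto
      also have "\<dots> \<le> s * seminorm ((S ^^ (2 ^ Suc n)) x)"
        using sq[of "2 ^ n"] by (simp add: s_def)
      finally have "s * (r ^ (2 ^ Suc n) * s) \<le> s * seminorm ((S ^^ (2 ^ Suc n)) x)"
        by (simp add: power_mult_distrib power2_eq_square power_mult mult_ac)
      then show ?case
        using \<open>s > 0\<close> by simp
    qed
    \<comment> \<open>If \<open>r > L\<close>, then \<open>iter\<close> and \<open>growth\<close>
      bound \<open>(L / r) ^ 2 ^ n\<close> below by \<open>s / C\<close> for every \<open>n\<close>,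
      although it tends to zero. As \<open>n\<close> is at most \<open>2 ^ n\<close>, an exponent
      \<open>n\<close> that is large enough for the plain power also serves here.\<close>
    have "r \<le> L"
    proof (rule ccontr)
      assume "\<not> r \<le> L"
      then have "r > 0" "L / r < 1" "L / r \<ge> 0"
        using \<open>L \<ge> 0\<close> by auto
      have "C \<ge> s"
        using growth[of 0] by (simp add: s_def)
      then have "C > 0"
        using \<open>s > 0\<close> by simp
      obtain n where n: "(L / r) ^ n < s / C"
        using real_arch_pow_inv[of "s / C" "L / r"] \<open>s > 0\<close> \<open>C > 0\<close> \<open>L / r < 1\<close> by auto
      have "(L / r) ^ (2 ^ n) \<le> (L / r) ^ n"
        using \<open>L / r < 1\<close> \<open>L / r \<ge> 0\<close> by (intro power_decreasing) (auto simp: less_imp_le)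
      then have "(L / r) ^ (2 ^ n) < s / C"
        using n by simp
      then have "C * L ^ (2 ^ n) < r ^ (2 ^ n) * s"
        using \<open>r > 0\<close> \<open>C > 0\<close> by (simp add: power_divide field_simps)
      also have "\<dots> \<le> C * L ^ (2 ^ n)"
        using iter[of n] growth[of "2 ^ n"] by simp
      finally show False
        by simp
    qed
    then show ?thesis
      using \<open>s > 0\<close> by (simp add: r_def s_def field_simps)
  qed
qed

end

section \<open>Complex Hilbert spaces\<close>

interpretation cinner: semi_inner "cinner :: 'a::chilbert_space \<Rightarrow> 'a \<Rightarrow> complex"
  rewrites "semi_inner.seminorm cinner = (norm :: 'a \<Rightarrow> real)"
proof -
  show "semi_inner (cinner :: 'a \<Rightarrow> 'a \<Rightarrow> complex)"
    by standard (rule cinner_commute cinner_add_left cinner_scaleC_left cinner_self_nonneg)+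
  then show "semi_inner.seminorm cinner = (norm :: 'a \<Rightarrow> real)"
    by (simp add: fun_eq_iff semi_inner.seminorm_def norm_eq_sqrt_cinner)
qed

lemma scaleC_minus1: "(- 1) *\<^sub>C x = - (x :: 'a::complex_vector)"
  using scaleR_scaleC[of "- 1" x] by simp

lemma cinner_minus_left: "cinner (- x) y = - cinner x (y :: 'a::chilbert_space)"
  using cinner_scaleC_left[of "- 1" x y] by (simp add: scaleC_minus1)

lemma cinner_minus_right: "cinner x (- y) = - cinner x (y :: 'a::chilbert_space)"
  using cinner.scaleC_right[of x "- 1" y] by (simp add: scaleC_minus1)

lemma cinner_diff_left: "cinner (x - y) z = cinner x z - cinner y (z :: 'a::chilbert_space)"
  using cinner_add_left[of x "- y" z] by (simp add: cinner_minus_left)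

lemma cinner_diff_right: "cinner z (x - y) = cinner z x - cinner z (y :: 'a::chilbert_space)"
  using cinner.add_right[of z x "- y"] by (simp add: cinner_minus_right)

lemma cinner_zero_left [simp]: "cinner 0 (y :: 'a::chilbert_space) = 0"
  using cinner_diff_left[of y y y] by simp

lemma cinner_zero_right [simp]: "cinner (y :: 'a::chilbert_space) 0 = 0"
  using cinner_diff_right[of y y y] by simp

lemma bounded_linear_scaleC: "bounded_linear (\<lambda>x::'a::chilbert_space. c *\<^sub>C x)"
  by (rule bounded_linear_intro[where K = "cmod c"])
    (auto simp: scaleC_add_right scaleR_scaleC scaleC_scaleC cinner.seminorm_scaleC mult_ac)

lemma bounded_linear_cinner_left: "bounded_linear (\<lambda>x::'a::chilbert_space. cinner x y)"
  by (rule bounded_linear_intro[where K = "norm y"])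
    (auto simp: cinner_add_left scaleR_scaleC cinner_scaleC_left scaleC_complex_def
      cinner.Cauchy_Schwarz)

lemma bounded_linear_cinner_right: "bounded_linear (\<lambda>y::'a::chilbert_space. cinner x y)"
  using cinner.Cauchy_Schwarz[of x]
  by (intro bounded_linear_intro[where K = "norm x"])
    (auto simp: cinner.add_right scaleR_scaleC cinner.scaleC_right scaleC_complex_def mult_ac)

lemma norm_add_power2:
  "(norm (x + y))\<^sup>2 = (norm x)\<^sup>2 + 2 * Re (cinner x y) + (norm (y :: 'a::chilbert_space))\<^sup>2"
proof -
  have "Re (cinner y x) = Re (cinner x y)"
    by (subst cinner_commute) simp
  then show ?thesis
    by (simp add: cinner.seminorm_power2 cinner_add_left cinner.add_right)
qed

lemma norm_diff_power2:
  "(norm (x - y))\<^sup>2 = (norm x)\<^sup>2 - 2 * Re (cinner x y) + (norm (y :: 'a::chilbert_space))\<^sup>2"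
  using norm_add_power2[of x "- y"] by (simp add: cinner_minus_right)

lemma cinner_eqI: "(\<And>z. cinner z x = cinner z y) \<Longrightarrow> x = (y :: 'a::chilbert_space)"
  by (metis cinner_diff_right cinner_eq_zero_iff eq_iff_diff_eq_0)

section \<open>Closed complex subspaces and orthogonal projections\<close>

definition csubspace :: "'a::complex_vector set \<Rightarrow> bool"
  where "csubspace M \<longleftrightarrow> 0 \<in> M \<and> (\<forall>x\<in>M. \<forall>y\<in>M. x + y \<in> M) \<and> (\<forall>c. \<forall>x\<in>M. c *\<^sub>C x \<in> M)"

lemma csubspaceD:
  assumes "csubspace M"
  shows "0 \<in> M" "x \<in> M \<Longrightarrow> y \<in> M \<Longrightarrow> x + y \<in> M" "x \<in> M \<Longrightarrow> c *\<^sub>C x \<in> M"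
  using assms by (auto simp: csubspace_def)

lemma csubspace_closure:
  fixes M :: "'a::chilbert_space set"
  assumes "csubspace M"
  shows "csubspace (closure M)"
  unfolding csubspace_def
proof (intro conjI ballI allI)
  show "0 \<in> closure M"
    using csubspaceD(1)[OF assms] closure_subset by blast
next
  fix x y
  assume "x \<in> closure M" "y \<in> closure M"
  then obtain f g where "\<forall>n. f n \<in> M" "f \<longlonglongrightarrow> x" "\<forall>n. g n \<in> M" "g \<longlonglongrightarrow> y"
    unfolding closure_sequential by blast
  then have "\<forall>n. f n + g n \<in> M" "(\<lambda>n. f n + g n) \<longlonglongrightarrow> x + y"
    using csubspaceD[OF assms] by (auto intro: tendsto_add)
  then show "x + y \<in> closure M"
    unfolding closure_sequential by fast
next
  fix c x
  assume "x \<in> closure M"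
  then have "c *\<^sub>C x \<in> closure ((*\<^sub>C) c ` M)"
    using closure_bounded_linear_image_subset[OF bounded_linear_scaleC, of c M] by blast
  moreover have "(*\<^sub>C) c ` M \<subseteq> M"
    using csubspaceD(3)[OF assms] by blast
  ultimately show "c *\<^sub>C x \<in> closure M"
    using closure_mono by blast
qed

text \<open>Minimizing sequences for the distance are Cauchy by the parallelogram law.\<close>

lemma closest_point_in_csubspace:
  fixes M :: "'a::chilbert_space set"
  assumes "csubspace M" "closed M"
  obtains y where "y \<in> M" "\<And>m. m \<in> M \<Longrightarrow> norm (x - y) \<le> norm (x - m)"
proof -
  define d where "d = infdist x M"
  have "M \<noteq> {}"
    using csubspaceD(1)[OF assms(1)] by blast
  have d_le: "d \<le> norm (x - m)" if "m \<in> M" for m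
    using infdist_le[OF that, of x] by (simp add: d_def dist_norm)
  have "d \<ge> 0"
    by (simp add: d_def infdist_nonneg)
  have "\<exists>m\<in>M. norm (x - m) < d + e" if "e > 0" for e
  proof -
    have "\<exists>m\<in>M. dist x m < d + e"
      using that \<open>M \<noteq> {}\<close> cInf_lessD[of "dist x ` M" "d + e"]
      by (auto simp: d_def infdist_def)
    then show ?thesis
      by (simp add: dist_norm)
  qed
  then have "\<forall>n. \<exists>m\<in>M. norm (x - m) < d + 1 / Suc n"
    by simp
  then obtain f where f: "\<And>n. f n \<in> M" "\<And>n. norm (x - f n) < d + 1 / Suc n"
    by metis
  have mid: "(norm (f m - f n))\<^sup>2 \<le> 2 * (norm (x - f m))\<^sup>2 + 2 * (norm (x - f n))\<^sup>2 - 4 * d\<^sup>2"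
    for m n
  proof -
    define u v where "u = x - f m" and "v = x - f n"
    \<comment> \<open>The midpoint lies in \<open>M\<close>, so its distance from \<open>x\<close>
      is at least \<open>d\<close>; this bounds \<open>norm (u + v)\<close> from below in the
      parallelogram law.\<close>
    have "(1 / 2) *\<^sub>C (f m + f n) \<in> M"
      using f(1) csubspaceD[OF assms(1)] by blast
    then have "d \<le> norm (x - (1 / 2) *\<^sub>C (f m + f n))"
      by (rule d_le)
    also have "x - (1 / 2) *\<^sub>C (f m + f n) = (1 / 2) *\<^sub>C (u + v)"
    proof -
      have "(1 / 2) *\<^sub>C z = (1 / 2 :: real) *\<^sub>R z" for z :: 'a
        by (simp add: scaleR_scaleC)
      then show ?thesis
        by (simp add: u_def v_def algebra_simps flip: scaleR_add_left)
    qed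
    finally have "2 * d \<le> norm (u + v)"
      by (simp add: cinner.seminorm_scaleC)
    then have "(2 * d)\<^sup>2 \<le> (norm (u + v))\<^sup>2"
      using \<open>d \<ge> 0\<close> by (intro power_mono) auto
    moreover have "f m - f n = v - u"
      by (simp add: u_def v_def)
    moreover have "(norm (v - u))\<^sup>2 + (norm (u + v))\<^sup>2 = 2 * (norm u)\<^sup>2 + 2 * (norm v)\<^sup>2"
      using norm_diff_power2[of u v] norm_add_power2[of u v] by (simp add: norm_minus_commute)
    ultimately show ?thesis
      by (simp add: u_def v_def power_mult_distrib)
  qed
  have lim: "(\<lambda>n. norm (x - f n)) \<longlonglongrightarrow> d"
  proof (rule tendsto_sandwich[OF always_eventually always_eventually tendsto_const])
    show "(\<lambda>n. d + 1 / real (Suc n)) \<longlonglongrightarrow> d"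
      using tendsto_add[OF tendsto_const[of d] LIMSEQ_inverse_real_of_nat]
      by (simp add: inverse_eq_divide)
  qed (use d_le f in \<open>auto intro: less_imp_le\<close>)
  have "Cauchy f"
  proof (rule metric_CauchyI)
    fix e :: real
    assume "e > 0"
    have "(\<lambda>n. (norm (x - f n))\<^sup>2) \<longlonglongrightarrow> d\<^sup>2"
      by (intro tendsto_power lim)
    \<comment> \<open>With the slack \<open>e\<^sup>2 / 4\<close> for both indices, the terms
      \<open>4 * d\<^sup>2\<close> in \<open>mid\<close> cancel and exactly \<open>e\<^sup>2\<close>
      remains.\<close>
    then have "\<forall>\<^sub>F n in sequentially. (norm (x - f n))\<^sup>2 < d\<^sup>2 + e\<^sup>2 / 4"
      using \<open>e > 0\<close> by (intro order_tendstoD(2)) auto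
    then obtain N where N: "\<And>n. n \<ge> N \<Longrightarrow> (norm (x - f n))\<^sup>2 < d\<^sup>2 + e\<^sup>2 / 4"
      unfolding eventually_sequentially by blast
    show "\<exists>N. \<forall>m\<ge>N. \<forall>n\<ge>N. dist (f m) (f n) < e"
    proof (intro exI allI impI)
      fix m n
      assume "m \<ge> N" "n \<ge> N"
      then have "(norm (f m - f n))\<^sup>2 < e\<^sup>2"
        using mid[of m n] N[of m] N[of n] by simp
      then show "dist (f m) (f n) < e"
        using \<open>e > 0\<close> by (simp add: dist_norm power2_less_imp_less)
    qed
  qed
  then obtain y where y: "f \<longlonglongrightarrow> y"
    using Cauchy_convergent convergent_def by blast
  have "y \<in> M"
    using closed_sequentially[OF assms(2) _ y] f(1) by blast
  moreover have "norm (x - y) = d"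
    by (rule LIMSEQ_unique[OF _ lim]) (intro tendsto_intros y)
  ultimately show thesis
    using that d_le by metis
qed

text \<open>The closest point works: if \<open>x - y\<close> were not orthogonal to some
  \<open>m\<close> in \<open>M\<close>, moving \<open>y\<close> slightly along a multiple of
  \<open>m\<close> would shorten the distance.\<close>

lemma orthogonal_projection_exists:
  fixes M :: "'a::chilbert_space set"
  assumes "csubspace M" "closed M"
  obtains y where "y \<in> M" "\<And>m. m \<in> M \<Longrightarrow> cinner (x - y) m = 0"
proof -
  obtain y where y: "y \<in> M" "\<And>m. m \<in> M \<Longrightarrow> norm (x - y) \<le> norm (x - m)"
    using closest_point_in_csubspace[OF assms] by blast
  have "cinner (x - y) m = 0" if "m \<in> M" for m
  proof -
    define w where "w = x - y"
    define p where "p = cinner w m"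
    \<comment> \<open>The optimal coefficient would be \<open>p\<close> over the squared norm of
      \<open>m\<close>; adding 1 to the denominator spares a case split on \<open>m = 0\<close> and
      still gives a contradiction unless \<open>p = 0\<close>.\<close>
    define k where "k = (norm m)\<^sup>2 + 1"
    have "k > 0"
      unfolding k_def by (smt (verit) zero_le_power2)
    define c where "c = p / complex_of_real k"
    have "y + c *\<^sub>C m \<in> M"
      using y(1) that csubspaceD[OF assms(1)] by blast
    then have "norm w \<le> norm (w - c *\<^sub>C m)"
      using y(2) by (simp add: w_def diff_diff_add)
    then have "(norm w)\<^sup>2 \<le> (norm (w - c *\<^sub>C m))\<^sup>2"
      by (intro power_mono) auto
    then have "2 * Re (cinner w (c *\<^sub>C m)) \<le> (cmod c * norm m)\<^sup>2"
      by (simp add: norm_diff_power2 cinner.seminorm_scaleC)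
    moreover have "cinner w (c *\<^sub>C m) = complex_of_real ((cmod p)\<^sup>2 / k)"
      by (simp add: cinner.scaleC_right c_def p_def[symmetric] complex_norm_square mult.commute
          del: of_real_power)
    moreover have "(cmod c * norm m)\<^sup>2 = (cmod p)\<^sup>2 * (norm m)\<^sup>2 / k\<^sup>2"
      using \<open>k > 0\<close> by (simp add: c_def norm_divide power_mult_distrib power_divide)
    ultimately have "2 * ((cmod p)\<^sup>2 / k) \<le> (cmod p)\<^sup>2 * (norm m)\<^sup>2 / k\<^sup>2"
      by simp
    then have "2 * k * (cmod p)\<^sup>2 \<le> (cmod p)\<^sup>2 * (norm m)\<^sup>2"
      using \<open>k > 0\<close> by (simp add: field_simps power2_eq_square)
    also have "\<dots> \<le> (cmod p)\<^sup>2 * k"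
      by (simp add: k_def mult_left_mono)
    finally have "k * (cmod p)\<^sup>2 \<le> 0"
      by (simp add: mult.commute)
    then show ?thesis
      using \<open>k > 0\<close> by (simp add: mult_le_0_iff p_def w_def)
  qed
  then show thesis
    using that y(1) by blast
qed

section \<open>Riesz representation and uniform boundedness\<close>

text \<open>A nonzero \<open>w\<close> orthogonal to the closed kernel of \<open>f\<close>
  represents \<open>f\<close> up to scaling, because \<open>x - (f x / f w) *\<^sub>C w\<close>
  always lies in the kernel.\<close>

theorem Riesz_representation:
  fixes f :: "'a::chilbert_space \<Rightarrow> complex"
  assumes "bounded_linear f" and hom: "\<And>c x. f (c *\<^sub>C x) = c * f x"
  obtains z where "\<And>x. f x = cinner x z"
proof (cases "\<forall>x. f x = 0")
  case True
  then show ?thesis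
    using that[of 0] by simp
next
  case False
  then obtain x0 where "f x0 \<noteq> 0"
    by blast
  interpret f: bounded_linear f
    by fact
  define M where "M = {x. f x = 0}"
  have "csubspace M"
    by (auto simp: csubspace_def M_def f.add f.zero hom)
  moreover have "closed M"
    unfolding M_def by (intro closed_Collect_eq continuous_intros linear_continuous_on assms)
  ultimately obtain y where y: "y \<in> M" "\<And>m. m \<in> M \<Longrightarrow> cinner (x0 - y) m = 0"
    using orthogonal_projection_exists by blast
  define w where "w = x0 - y"
  have "f w \<noteq> 0"
    using \<open>f x0 \<noteq> 0\<close> y(1) by (simp add: w_def f.diff M_def)
  then have "cinner w w \<noteq> 0"
    using f.zero cinner_eq_zero_iff by metis
  have "f x = cinner x ((cnj (f w) / cinner w w) *\<^sub>C w)" for x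
  proof -
    have "x - (f x / f w) *\<^sub>C w \<in> M"
      using \<open>f w \<noteq> 0\<close> by (simp add: M_def f.diff hom)
    then have "cinner w (x - (f x / f w) *\<^sub>C w) = 0"
      using y(2) by (simp add: w_def)
    then have "cinner (x - (f x / f w) *\<^sub>C w) w = 0"
      by (metis cinner_commute complex_cnj_zero)
    then have "f w * cinner x w = f x * cinner w w"
      using \<open>f w \<noteq> 0\<close> by (simp add: cinner_diff_left cinner_scaleC_left field_simps)
    moreover have "cnj (cinner w w) = cinner w w"
      using cinner_commute[of w w] by simp
    ultimately show ?thesis
      using \<open>cinner w w \<noteq> 0\<close> by (simp add: cinner.scaleC_right field_simps)
  qed
  then show thesis
    by (rule that)
qed

text \<open>By Baire's theorem one of the closed sets \<open>E n\<close> covering the space contains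
  a ball, and linearity spreads the bound from there. The weights \<open>w i\<close> may vanish, so
  they are kept as factors and never divided by.\<close>

lemma uniform_boundedness:
  fixes F :: "'i \<Rightarrow> 'a::banach \<Rightarrow> 'b::real_normed_vector"
  assumes lin: "\<And>i. bounded_linear (F i)"
    and nonneg: "\<And>i. w i \<ge> 0"
    and pointwise: "\<And>x. \<exists>K. \<forall>i. norm (F i x) \<le> K * w i"
  obtains K where "K \<ge> 0" "\<And>i x. norm (F i x) \<le> K * norm x * w i"
proof -
  define E where "E n = {x. \<forall>i. norm (F i x) \<le> real n * w i}" for n :: nat
  have closed: "closed (E n)" for n
    unfolding E_def
    by (intro closed_Collect_all closed_Collect_le continuous_intros linear_continuous_on lin)
  have "x \<in> \<Union>(range E)" for x
  proof -
    obtain K where K: "\<And>i. norm (F i x) \<le> K * w i"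
      using pointwise by blast
    obtain n where "K \<le> real n"
      using real_arch_simple by blast
    then have "x \<in> E n"
      unfolding E_def using order_trans[OF K mult_right_mono[OF _ nonneg]] by blast
    then show ?thesis
      by blast
  qed
  then have "\<Union>(range E) = UNIV"
    by blast
  moreover have "interior (\<Union>(range E)) = {}" if "\<And>n. interior (E n) = {}"
    using Met_TC.metric_Baire_category_alt[of "range E"] closed that
    by (auto simp: complete_UNIV)
  ultimately obtain n where "interior (E n) \<noteq> {}"
    by fastforce
  then obtain x0 e where "e > 0" and ball: "cball x0 e \<subseteq> E n"
    by (metis ex_in_conv mem_interior_cball)
  show thesis
  proof (rule that)
    show "2 * real n / e \<ge> 0"
      using \<open>e > 0\<close> by simp
  next
    fix i x
    interpret bounded_linear "F i"
      by (rule lin)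
    show "norm (F i x) \<le> (2 * real n / e) * norm x * w i"
    proof (cases "x = 0")
      case True
      then show ?thesis
        by (simp add: zero)
    next
      case False
      \<comment> \<open>Since \<open>F i h\<close> is the difference of the values at
        \<open>x0 + h\<close> and \<open>x0\<close>, both in the ball, the bound doubles; rescaling
        \<open>h\<close> to \<open>x\<close> contributes \<open>norm x / e\<close>.\<close>
      define h where "h = (e / norm x) *\<^sub>R x"
      have "norm h = e"
        using False \<open>e > 0\<close> by (simp add: h_def)
      then have "x0 + h \<in> E n" "x0 \<in> E n"
        using ball \<open>e > 0\<close> by (auto simp: dist_norm)
      then have "norm (F i (x0 + h)) \<le> real n * w i" "norm (F i x0) \<le> real n * w i"
        by (auto simp: E_def)
      then have "norm (F i h) \<le> 2 * real n * w i"
        using norm_triangle_ineq4[of "F i (x0 + h)" "F i x0"] by (simp add: add)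
      moreover have "norm (F i h) = e / norm x * norm (F i x)"
        using \<open>e > 0\<close> by (simp add: h_def scaleR)
      ultimately show ?thesis
        using False \<open>e > 0\<close> by (simp add: field_simps)
    qed
  qed
qed

section \<open>Bounded operators and their adjoints\<close>

lemma bounded_opsD:
  assumes "T \<in> bounded_ops"
  shows "bounded_linear T" "T (c *\<^sub>C x) = c *\<^sub>C T x"
  using assms by (auto simp: bounded_ops_def)

lemma bounded_opsI:
  assumes "\<And>x y. T (x + y) = T x + T y" "\<And>c x. T (c *\<^sub>C x) = c *\<^sub>C T x"
    "\<And>x. norm (T x) \<le> norm x * K"
  shows "T \<in> bounded_ops"
  using assms by (auto simp: bounded_ops_def scaleR_scaleC intro!: bounded_linear_intro)

lemma csubspace_range:
  fixes T :: "'a::chilbert_space \<Rightarrow> 'a"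
  assumes T: "T \<in> bounded_ops"
  shows "csubspace (range T)"
  unfolding csubspace_def
proof (intro conjI ballI allI)
  interpret bounded_linear T
    by (rule bounded_opsD(1)[OF T])
  show "0 \<in> range T"
    using zero by (metis rangeI)
  show "x + y \<in> range T" if "x \<in> range T" "y \<in> range T" for x y
    using that by (auto simp flip: add)
  show "c *\<^sub>C x \<in> range T" if "x \<in> range T" for c x
    using that by (auto simp flip: bounded_opsD(2)[OF T])
qed

text \<open>\<open>S y\<close> is the Riesz vector of the functional
  \<open>\<lambda>x. cinner (T x) y\<close>. Inserting \<open>S x\<close> into the defining identity
  shows that a bound for \<open>T\<close> also bounds \<open>S\<close>.\<close>

lemma ex_adjoint:
  fixes T :: "'a::chilbert_space \<Rightarrow> 'a"
  assumes T: "T \<in> bounded_ops"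
  shows "\<exists>S. S \<in> bounded_ops \<and> (\<forall>x y. cinner (T x) y = cinner x (S y))"
proof -
  interpret bounded_linear T
    by (rule bounded_opsD(1)[OF T])
  have "\<exists>z. \<forall>x. cinner (T x) y = cinner x z" for y
  proof -
    have "bounded_linear (\<lambda>x. cinner (T x) y)"
      by (rule bounded_linear_compose[OF bounded_linear_cinner_left bounded_linear_axioms])
    moreover have "cinner (T (c *\<^sub>C x)) y = c * cinner (T x) y" for c x
      by (simp add: bounded_opsD(2)[OF T] cinner_scaleC_left)
    ultimately obtain z where "\<And>x. cinner (T x) y = cinner x z"
      by (rule Riesz_representation) blast
    then show ?thesis
      by blast
  qed
  then obtain S where S: "\<And>x y. cinner (T x) y = cinner x (S y)"
    by metis
  obtain K where K: "\<And>x. norm (T x) \<le> norm x * K"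
    using bounded by blast
  have "S \<in> bounded_ops"
  proof (rule bounded_opsI)
    show "S (x + y) = S x + S y" for x y
      by (rule cinner_eqI) (simp add: cinner.add_right flip: S)
    show "S (c *\<^sub>C x) = c *\<^sub>C S x" for c x
      by (rule cinner_eqI) (simp add: cinner.scaleC_right flip: S)
    show "norm (S x) \<le> norm x * K" for x
    proof (cases "S x = 0")
      case True
      have "0 \<le> norm x * K"
        using K[of x] norm_ge_zero order_trans by blast
      with True show ?thesis
        by simp
    next
      case False
      have "norm (S x) * norm (S x) = Re (cinner (T (S x)) x)"
        by (simp add: S cinner.seminorm_power2 flip: power2_eq_square)
      also have "\<dots> \<le> norm (T (S x)) * norm x"
        using complex_Re_le_cmod cinner.Cauchy_Schwarz by (rule order_trans)
      also have "\<dots> \<le> norm (S x) * K * norm x"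
        by (intro mult_right_mono K) simp
      finally have "norm (S x) * norm (S x) \<le> norm (S x) * (norm x * K)"
        by (simp add: mult_ac)
      then show ?thesis
        using False by simp
    qed
  qed
  then show ?thesis
    using S by blast
qed

text \<open>Existence and uniqueness give the definite description in \<open>adjoint_op\<close> its
  intended meaning.\<close>

lemma adjoint_op:
  fixes T :: "'a::chilbert_space \<Rightarrow> 'a"
  assumes "T \<in> bounded_ops"
  shows adjoint_op_bounded: "adjoint_op T \<in> bounded_ops"
    and cinner_adjoint_op: "cinner (T x) y = cinner x (adjoint_op T y)"
proof -
  have "\<exists>!S. S \<in> bounded_ops \<and> (\<forall>x y. cinner (T x) y = cinner x (S y))"
  proof (rule ex_ex1I[OF ex_adjoint[OF assms]])
    fix S S'
    assume "S \<in> bounded_ops \<and> (\<forall>x y. cinner (T x) y = cinner x (S y))"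
      and "S' \<in> bounded_ops \<and> (\<forall>x y. cinner (T x) y = cinner x (S' y))"
    then have "S y = S' y" for y
      by - (rule cinner_eqI, metis)
    then show "S = S'"
      by blast
  qed
  from theI'[OF this, folded adjoint_op_def] show "adjoint_op T \<in> bounded_ops"
    "cinner (T x) y = cinner x (adjoint_op T y)"
    by blast+
qed

section \<open>The semi-inner product of a positive operator\<close>

locale positive_operator =
  fixes A :: "'a::chilbert_space \<Rightarrow> 'a"
  assumes positive: "positive_op A"
begin

lemma bounded_op: "A \<in> bounded_ops"
  using positive by (simp add: positive_op_def)

interpretation A: bounded_linear A
  by (rule bounded_opsD(1)[OF bounded_op])

lemma Im_self: "Im (cinner (A x) x) = 0"
  using positive by (simp add: positive_op_def complex_nonneg_Reals_iff)

text \<open>Polarization with \<open>x + y\<close> and \<open>x + \<i> y\<close>.\<close>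

lemma symmetric: "cinner (A x) y = cinner x (A y)"
proof -
  have "Im (cinner (A x) y) + Im (cinner (A y) x) = 0"
    using Im_self[of "x + y"] by (simp add: A.add cinner_add_left cinner.add_right Im_self)
  moreover have "Re (cinner (A y) x) = Re (cinner (A x) y)"
    using Im_self[of "x + \<i> *\<^sub>C y"]
    by (simp add: A.add cinner_add_left cinner.add_right Im_self bounded_opsD(2)[OF bounded_op]
        cinner_scaleC_left cinner.scaleC_right)
  ultimately have "cinner (A x) y = cnj (cinner (A y) x)"
    by (simp add: complex_eq_iff)
  then show ?thesis
    by (metis cinner_commute)
qed

sublocale semi_inner "A_inner A"
  rewrites "semi_inner.seminorm (A_inner A) = A_norm A"
proof -
  show *: "semi_inner (A_inner A)"
    unfolding A_inner_def
  proof
    show "cinner (A x) y = cnj (cinner (A y) x)" for x y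
      by (metis cinner_commute symmetric)
    show "cinner (A x) x \<in> \<real>\<^sub>\<ge>\<^sub>0" for x
      using positive by (simp add: positive_op_def)
  qed (simp_all add: A.add cinner_add_left cinner_scaleC_left bounded_opsD(2)[OF bounded_op])
  show "semi_inner.seminorm (A_inner A) = A_norm A"
    by (simp add: fun_eq_iff semi_inner.seminorm_def[OF *] A_norm_def)
qed

text \<open>Transfers the growth of iterates from the norm to the seminorm, as Krein's argument
  requires.\<close>

lemma A_norm_le: obtains K where "K \<ge> 0" "\<And>x. A_norm A x \<le> K * norm x"
proof -
  obtain K where K: "K > 0" "\<And>x. norm (A x) \<le> norm x * K"
    using A.pos_bounded by blast
  have "A_norm A x \<le> sqrt K * norm x" for x
  proof -
    have "(A_norm A x)\<^sup>2 \<le> norm (A x) * norm x"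
      unfolding seminorm_power2 A_inner_def
      using complex_Re_le_cmod cinner.Cauchy_Schwarz by (rule order_trans)
    also have "\<dots> \<le> norm x * K * norm x"
      by (intro mult_right_mono K) simp
    also have "\<dots> = (sqrt K * norm x)\<^sup>2"
      using K(1) by (simp add: power2_eq_square)
    finally show ?thesis
      by (rule power2_le_imp_le) (simp add: K(1) less_imp_le)
  qed
  then show thesis
    using that[of "sqrt K"] K(1) by simp
qed

text \<open>Cauchy-Schwarz for the form, with second vector \<open>A x\<close>, applies because
  \<open>A_inner A x (A x)\<close> is the squared norm of \<open>A x\<close>.\<close>

lemma A_eq_0_if_A_norm_eq_0:
  assumes "A_norm A x = 0"
  shows "A x = 0"
proof -
  have "cmod (A_inner A x (A x)) \<le> 0"
    using Cauchy_Schwarz[of x "A x"] assms by simp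
  then show ?thesis
    by (simp add: A_inner_def cinner_eq_zero_iff)
qed

text \<open>Ensures that the sets under the suprema are nonempty.\<close>

lemma ex_A_norm_eq_1:
  assumes "A \<noteq> (\<lambda>x. 0)"
  obtains x where "A_norm A x = 1"
proof -
  obtain z where "A z \<noteq> 0"
    using assms by blast
  then have "A_norm A z \<noteq> 0"
    using A_eq_0_if_A_norm_eq_0 by blast
  then have "A_norm A ((1 / complex_of_real (A_norm A z)) *\<^sub>C z) = 1"
    by (simp add: seminorm_scaleC norm_divide seminorm_nonneg)
  then show thesis
    by (rule that)
qed

section \<open>Douglas' theorem and the A-adjoint\<close>

text \<open>By symmetry of \<open>A\<close>, a kernel vector is orthogonal to
  \<open>range A\<close>, by continuity to its closure, and hence to itself.\<close>

lemma eq_0_if_in_closure_range: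
  assumes "y \<in> closure (range A)" "A y = 0"
  shows "y = 0"
proof -
  have "closed {w. cinner y w = 0}"
    by (intro closed_Collect_eq continuous_intros linear_continuous_on bounded_linear_cinner_right)
  moreover have "range A \<subseteq> {w. cinner y w = 0}"
    using assms(2) by (auto simp flip: symmetric)
  ultimately have "closure (range A) \<subseteq> {w. cinner y w = 0}"
    by (rule closure_minimal[rotated])
  then show ?thesis
    using assms(1) cinner_eq_zero_iff by blast
qed

text \<open>This injectivity of \<open>A\<close> gives uniqueness of the reduced solution and,
  later, its linearity.\<close>

lemma eq_if_in_closure_range:
  assumes "u \<in> closure (range A)" "v \<in> closure (range A)" "A u = A v"
  shows "u = v"
proof -
  have sub: "csubspace (closure (range A))"
    by (rule csubspace_closure[OF csubspace_range[OF bounded_op]])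
  have "u + (- 1) *\<^sub>C v \<in> closure (range A)"
    using assms by (intro csubspaceD[OF sub])
  then have "u - v \<in> closure (range A)"
    by (simp add: scaleC_minus1)
  then show ?thesis
    using eq_0_if_in_closure_range[of "u - v"] assms(3) by (simp add: A.diff)
qed

text \<open>Projecting any preimage \<open>y0\<close> onto the closure of the range does not change
  its image: the error is orthogonal to \<open>A (A (y0 - y))\<close>, which by symmetry makes
  \<open>A (y0 - y)\<close> vanish.\<close>

lemma ex_preimage_in_closure_range:
  assumes "v \<in> range A"
  obtains y where "y \<in> closure (range A)" "A y = v"
proof -
  obtain y0 where y0: "v = A y0"
    using assms by blast
  obtain y where y: "y \<in> closure (range A)" "\<And>m. m \<in> closure (range A) \<Longrightarrow> cinner (y0 - y) m = 0"
    using orthogonal_projection_exists[of "closure (range A)"]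
      csubspace_closure[OF csubspace_range[OF bounded_op]] by blast
  have "A (A (y0 - y)) \<in> closure (range A)"
    by (meson closure_subset rangeI subsetD)
  have "cinner (A (y0 - y)) (A (y0 - y)) = cinner (y0 - y) (A (A (y0 - y)))"
    by (rule symmetric)
  also have "\<dots> = 0"
    by (rule y(2)) fact
  finally have "A y = v"
    by (simp add: cinner_eq_zero_iff A.diff y0)
  with y(1) show thesis
    by (rule that)
qed

text \<open>Boundedness comes from the uniform boundedness principle: the functionals
  \<open>\<lambda>x. cinner (X x) (A z) = cinner x (A (T z))\<close> are pointwise bounded by \<open>norm (X x) * norm (A z)\<close>.\<close>

lemma ex_reduced_solution:
  assumes T: "T \<in> A_adjointable A"
  shows "\<exists>X. X \<in> bounded_ops \<and> A \<circ> X = adjoint_op T \<circ> A \<and> range X \<subseteq> closure (range A)"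
proof -
  have Tb: "T \<in> bounded_ops" and ran: "range (adjoint_op T \<circ> A) \<subseteq> range A"
    using T by (auto simp: A_adjointable_def)
  have sub: "csubspace (closure (range A))"
    by (rule csubspace_closure[OF csubspace_range[OF bounded_op]])
  have "\<exists>y. y \<in> closure (range A) \<and> A y = adjoint_op T (A x)" for x
    using ran ex_preimage_in_closure_range[of "adjoint_op T (A x)"] by fastforce
  then obtain X where X: "\<And>x. X x \<in> closure (range A)" "\<And>x. A (X x) = adjoint_op T (A x)"
    by metis
  interpret adj: bounded_linear "adjoint_op T"
    by (rule bounded_opsD(1)[OF adjoint_op_bounded[OF Tb]])
  have X_range: "cinner (X x) (A z) = cinner x (A (T z))" for x z
  proof -
    have "cinner (X x) (A z) = cinner (adjoint_op T (A x)) z"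
      using X(2) symmetric by metis
    also have "\<dots> = cinner (A x) (T z)"
      by (metis cinner_adjoint_op[OF Tb] cinner_commute)
    finally show ?thesis
      by (simp add: symmetric)
  qed
  define F where "F z x = cinner x (A (T z))" for z x
  obtain K where "K \<ge> 0" and K: "\<And>z x. norm (F z x) \<le> K * norm x * norm (A z)"
  proof (rule uniform_boundedness)
    show "bounded_linear (F z)" for z
      unfolding F_def by (rule bounded_linear_cinner_left)
    show "\<exists>K. \<forall>z. norm (F z x) \<le> K * norm (A z)" for x
      using cinner.Cauchy_Schwarz[of "X x"] by (auto simp: F_def simp flip: X_range)
  qed auto
  have "norm (X x) \<le> norm x * K" for x
  proof -
    \<comment> \<open>The bound holds for \<open>w\<close> in \<open>range A\<close> and passes to
      the closure by continuity; since \<open>X x\<close> lies there, \<open>w = X x\<close> may be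
      inserted.\<close>
    have "closed {w. cmod (cinner (X x) w) \<le> K * norm x * norm w}"
      by (intro closed_Collect_le continuous_intros linear_continuous_on bounded_linear_cinner_right)
    moreover have "range A \<subseteq> {w. cmod (cinner (X x) w) \<le> K * norm x * norm w}"
      using K by (auto simp: F_def X_range)
    ultimately have "closure (range A) \<subseteq> {w. cmod (cinner (X x) w) \<le> K * norm x * norm w}"
      by (rule closure_minimal[rotated])
    then have "cmod (cinner (X x) (X x)) \<le> K * norm x * norm (X x)"
      using X(1) by blast
    then have *: "norm (X x) * norm (X x) \<le> (K * norm x) * norm (X x)"
      by (simp add: cinner.self_eq power2_eq_square norm_mult)
    show ?thesis
      using * \<open>K \<ge> 0\<close> by (cases "X x = 0") (simp_all add: mult.commute)
  qed
  then have "X \<in> bounded_ops"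
  proof (rule bounded_opsI[rotated 2])
    \<comment> \<open>Both sides lie in the closure of the range and have the same image under
      \<open>A\<close>.\<close>
    show "X (x + y) = X x + X y" for x y
      by (rule eq_if_in_closure_range) (auto simp: X A.add adj.add intro!: csubspaceD(2)[OF sub])
    show "X (c *\<^sub>C x) = c *\<^sub>C X x" for c x
      by (rule eq_if_in_closure_range) (auto simp: X bounded_opsD(2)[OF bounded_op]
          bounded_opsD(2)[OF adjoint_op_bounded[OF Tb]] intro!: csubspaceD(3)[OF sub])
  qed
  then show ?thesis
    using X by (intro exI[of _ X]) auto
qed

text \<open>Injectivity of \<open>A\<close> on the closure of its range makes the reduced solution
  unique, so the definite description denotes it; the identity then comes from
  \<open>A \<circ> X = adjoint_op T \<circ> A\<close> and the symmetry of \<open>A\<close>.\<close>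

lemma A_adjoint:
  assumes T: "T \<in> A_adjointable A"
  shows A_adjoint_bounded: "A_adjoint A T \<in> bounded_ops"
    and A_inner_A_adjoint: "A_inner A (T x) y = A_inner A x (A_adjoint A T y)"
proof -
  have Tb: "T \<in> bounded_ops"
    using T by (simp add: A_adjointable_def)
  have "\<exists>!X. X \<in> bounded_ops \<and> A \<circ> X = adjoint_op T \<circ> A \<and> range X \<subseteq> closure (range A)"
  proof (rule ex_ex1I[OF ex_reduced_solution[OF T]])
    fix X Y
    assume X: "X \<in> bounded_ops \<and> A \<circ> X = adjoint_op T \<circ> A \<and> range X \<subseteq> closure (range A)"
      and Y: "Y \<in> bounded_ops \<and> A \<circ> Y = adjoint_op T \<circ> A \<and> range Y \<subseteq> closure (range A)"
    have "X z = Y z" for z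
      by (rule eq_if_in_closure_range) (use X Y in \<open>auto simp: fun_eq_iff\<close>)
    then show "X = Y"
      by blast
  qed
  from theI'[OF this, folded A_adjoint_def]
  have X: "A_adjoint A T \<in> bounded_ops" "A \<circ> A_adjoint A T = adjoint_op T \<circ> A"
    by blast+
  show "A_adjoint A T \<in> bounded_ops"
    by fact
  have "A_inner A (T x) y = cinner x (adjoint_op T (A y))"
    by (simp add: A_inner_def symmetric cinner_adjoint_op[OF Tb])
  also have "\<dots> = A_inner A x (A_adjoint A T y)"
    using fun_cong[OF X(2), of y] by (simp add: A_inner_def symmetric)
  finally show "A_inner A (T x) y = A_inner A x (A_adjoint A T y)" .
qed

section \<open>A-boundedness of A-adjointable operators\<close>

text \<open>The operator \<open>S\<close> is symmetric for the form, and its iterates grow at most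
  like \<open>L ^ n\<close> in the norm, hence also in the seminorm. Krein's argument bounds
  \<open>S\<close> by \<open>L\<close>, and the squared seminorm of \<open>T x\<close> is the form
  value of \<open>x\<close> and \<open>S x\<close>, whence the factor \<open>sqrt L\<close>.\<close>

lemma A_norm_image_le:
  assumes T: "T \<in> A_adjointable A"
  obtains K where "K \<ge> 0" "\<And>x. A_norm A (T x) \<le> K * A_norm A x"
proof -
  define S where "S = (\<lambda>x. A_adjoint A T (T x))"
  have S: "A_inner A (T x) (T y) = A_inner A x (S y)" for x y
    by (simp add: S_def A_inner_A_adjoint[OF T])
  have sym: "A_inner A (S x) y = A_inner A x (S y)" for x y
    by (metis S commute)
  have "bounded_linear T"
    using T by (simp add: A_adjointable_def bounded_ops_def)
  then have "bounded_linear S"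
    unfolding S_def
    by (rule bounded_linear_compose[OF bounded_opsD(1)[OF A_adjoint_bounded[OF T]]])
  then obtain L where L: "L > 0" "\<And>x. norm (S x) \<le> norm x * L"
    using bounded_linear.pos_bounded by blast
  obtain K where K: "K \<ge> 0" "\<And>x. A_norm A x \<le> K * norm x"
    using A_norm_le by blast
  have "A_norm A (S x) \<le> L * A_norm A x" for x
  proof (rule symmetric_seminorm_le[OF sym])
    fix n
    have "norm ((S ^^ n) x) \<le> norm x * L ^ n"
    proof (induction n)
      case (Suc n)
      have "norm ((S ^^ Suc n) x) \<le> norm ((S ^^ n) x) * L"
        using L(2) by simp
      also have "\<dots> \<le> norm x * L ^ n * L"
        using Suc L(1) by (intro mult_right_mono) auto
      finally show ?case
        by (simp add: mult_ac)
    qed simp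
    then have "K * norm ((S ^^ n) x) \<le> K * (norm x * L ^ n)"
      using K(1) by (rule mult_left_mono)
    then show "A_norm A ((S ^^ n) x) \<le> (K * norm x) * L ^ n"
      using K(2)[of "(S ^^ n) x"] by (simp add: mult.assoc)
  qed (use L(1) in simp)
  then have "A_norm A (T x) \<le> sqrt L * A_norm A x" for x
  proof -
    have "(A_norm A (T x))\<^sup>2 = Re (A_inner A x (S x))"
      by (simp add: seminorm_power2 S)
    also have "\<dots> \<le> A_norm A x * A_norm A (S x)"
      using complex_Re_le_cmod Cauchy_Schwarz by (rule order_trans)
    also have "\<dots> \<le> A_norm A x * (L * A_norm A x)"
      by (intro mult_left_mono \<open>A_norm A (S x) \<le> L * A_norm A x\<close> seminorm_nonneg)
    also have "\<dots> = (sqrt L * A_norm A x)\<^sup>2"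
      using L(1) by (simp add: power2_eq_square)
    finally show ?thesis
      by (rule power2_le_imp_le) (simp add: L(1) less_imp_le seminorm_nonneg)
  qed
  then show thesis
    using that[of "sqrt L"] L(1) by simp
qed

text \<open>A-boundedness makes the supremum genuine, and normalizing \<open>x\<close> reduces to
  it. Vectors of seminorm zero cannot be normalized; for them A-boundedness makes both sides
  zero.\<close>

lemma A_norm_image_le_A_op_norm:
  assumes T: "T \<in> A_adjointable A"
  shows "A_norm A (T x) \<le> A_op_norm A T * A_norm A x"
proof -
  have hom: "T (c *\<^sub>C x) = c *\<^sub>C T x" for c x
    using T by (simp add: A_adjointable_def bounded_ops_def)
  obtain K where K: "\<And>x. A_norm A (T x) \<le> K * A_norm A x"
    using A_norm_image_le[OF T] by blast
  show ?thesis
  proof (cases "A_norm A x = 0")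
    case True
    then show ?thesis
      using K[of x] by simp
  next
    case False
    define c where "c = 1 / complex_of_real (A_norm A x)"
    have c: "cmod c = 1 / A_norm A x"
      by (simp add: c_def norm_divide seminorm_nonneg)
    have "bdd_above {A_norm A (T x) | x. A_norm A x = 1}"
      by (intro bdd_aboveI[of _ K]) (auto, metis K mult.right_neutral)
    moreover have "A_norm A (c *\<^sub>C x) = 1"
      using False by (simp add: seminorm_scaleC c)
    ultimately have "A_norm A (T (c *\<^sub>C x)) \<le> A_op_norm A T"
      unfolding A_op_norm_def by (intro cSup_upper) auto
    moreover have "A_norm A x > 0"
      using False seminorm_nonneg[of x] by simp
    ultimately show ?thesis
      by (simp add: hom seminorm_scaleC c field_simps)
  qed
qed

end

section \<open>The bound for the A-Davis-Wielandt radius\<close>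

theorem corollary2p7:
  fixes A T :: "'a::chilbert_space \<Rightarrow> 'a"
  assumes "positive_op A"
    and "A \<noteq> (\<lambda>x. 0)"
    and "T \<in> A_adjointable A"
  shows "A_Davis_Wielandt_radius A T
    \<le> sqrt (max ((A_op_norm A T)\<^sup>2) (A_op_norm A T ^ 4)
        + A_numerical_radius A (A_adjoint A T \<circ> T \<circ> T))"
proof -
  interpret positive_operator A
    by standard fact
  note T = \<open>T \<in> A_adjointable A\<close>
  define N where "N = A_op_norm A T"
  define X where "X = A_adjoint A T"
  have X: "A_inner A (T x) y = A_inner A x (X y)" for x y
    unfolding X_def by (rule A_inner_A_adjoint[OF T])
  have X': "A_inner A (X x) y = A_inner A x (T y)" for x y
    by (metis X commute)
  have le_N: "A_norm A (T x) \<le> N * A_norm A x" for x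
    unfolding N_def by (rule A_norm_image_le_A_op_norm[OF T])
  obtain e where "A_norm A e = 1"
    using ex_A_norm_eq_1 assms(2) by blast
  then have "N \<ge> 0"
    using le_N[of e] order_trans[OF seminorm_nonneg] by simp
  \<comment> \<open>The A-adjoint inherits the bound of \<open>T\<close>: the squared seminorm of
    \<open>X y\<close> is a form value of \<open>T (X y)\<close> and \<open>y\<close>, and one
    factor \<open>A_norm A (X y)\<close> cancels.\<close>
  have X_le_N: "A_norm A (X y) \<le> N * A_norm A y" for y
  proof (cases "A_norm A (X y) = 0")
    case True
    then show ?thesis
      using \<open>N \<ge> 0\<close> by (simp add: seminorm_nonneg)
  next
    case False
    then have "A_norm A (X y) > 0"
      using seminorm_nonneg[of "X y"] by simp
    have "(A_norm A (X y))\<^sup>2 = Re (A_inner A (T (X y)) y)"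
      by (simp add: seminorm_power2 X)
    also have "\<dots> \<le> A_norm A (T (X y)) * A_norm A y"
      using complex_Re_le_cmod Cauchy_Schwarz by (rule order_trans)
    also have "\<dots> \<le> N * A_norm A (X y) * A_norm A y"
      by (intro mult_right_mono le_N seminorm_nonneg)
    finally have "A_norm A (X y) * A_norm A (X y) \<le> A_norm A (X y) * (N * A_norm A y)"
      by (simp add: power2_eq_square mult_ac)
    then show ?thesis
      using \<open>A_norm A (X y) > 0\<close> by simp
  qed
  have radius: "cmod (A_inner A (X (T (T x))) x) \<le> A_numerical_radius A (X \<circ> T \<circ> T)"
    if "A_norm A x = 1" for x
  proof -
    \<comment> \<open>The crude cubic bound serves only to show that the numerical radius is a
      supremum of a bounded set.\<close>
    have "cmod (A_inner A (X (T (T x))) x) \<le> N * (N * N)" if "A_norm A x = 1" for x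
    proof -
      have "cmod (A_inner A (X (T (T x))) x) \<le> A_norm A (X (T (T x)))"
        using Cauchy_Schwarz[of "X (T (T x))" x] that by simp
      also have "\<dots> \<le> N * A_norm A (T (T x))"
        by (rule X_le_N)
      also have "\<dots> \<le> N * (N * A_norm A (T x))"
        by (intro mult_left_mono le_N \<open>N \<ge> 0\<close>)
      also have "\<dots> \<le> N * (N * (N * A_norm A x))"
        by (intro mult_left_mono le_N \<open>N \<ge> 0\<close>)
      finally show ?thesis
        by (simp add: that)
    qed
    then have "bdd_above {cmod (A_inner A ((X \<circ> T \<circ> T) x) x) | x. A_norm A x = 1}"
      by (intro bdd_aboveI[of _ "N * (N * N)"]) auto
    then show ?thesis
      unfolding A_numerical_radius_def using that by (intro cSup_upper) auto
  qed
  have "sqrt ((cmod (A_inner A (T x) x))\<^sup>2 + A_norm A (T x) ^ 4)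
      \<le> sqrt (max (N\<^sup>2) (N ^ 4) + A_numerical_radius A (X \<circ> T \<circ> T))"
    if x: "A_norm A x = 1" for x
  proof (rule real_sqrt_le_mono)
    have "A_norm A (T x) \<le> N"
      using le_N[of x] x by simp
    then have a: "(A_norm A (T x))\<^sup>2 \<le> N\<^sup>2"
      by (intro power_mono seminorm_nonneg)
    have "A_norm A (X (T x)) \<le> N * N"
      using X_le_N[of "T x"] mult_left_mono[OF \<open>A_norm A (T x) \<le> N\<close> \<open>N \<ge> 0\<close>] by simp
    then have "(A_norm A (X (T x)))\<^sup>2 \<le> (N * N)\<^sup>2"
      by (intro power_mono seminorm_nonneg)
    \<comment> \<open>The vector \<open>X (T x)\<close> picks up two factors \<open>N\<close> and
      \<open>T x\<close> only one; this is the origin of the maximum of \<open>N\<^sup>2\<close> and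
      \<open>N ^ 4\<close>.\<close>
    then have b: "(A_norm A (X (T x)))\<^sup>2 \<le> N ^ 4"
      by (simp add: power2_eq_square power4_eq_xxxx mult.assoc)
    have "cmod (A_inner A (T x) x) = cmod (A_inner A x (T x))"
      by (metis commute complex_mod_cnj)
    moreover have "A_norm A (T x) ^ 4 = (cmod (A_inner A x (X (T x))))\<^sup>2"
    proof -
      have "A_inner A x (X (T x)) = complex_of_real ((A_norm A (T x))\<^sup>2)"
        by (simp only: self_eq flip: X)
      then show ?thesis
        by (simp add: norm_power flip: power_mult)
    qed
    \<comment> \<open>Moving \<open>X\<close> to the right as \<open>T\<close>, and then the outer
      \<open>T\<close> to the right as \<open>X\<close>, identifies the cross term of Bombieri's
      inequality with a value bounded by the numerical radius.\<close>
    moreover have "A_inner A (X (T (T x))) x = A_inner A (T x) (X (T x))"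
      by (simp only: X' X)
    ultimately have "(cmod (A_inner A (T x) x))\<^sup>2 + A_norm A (T x) ^ 4
        \<le> max ((A_norm A (T x))\<^sup>2) ((A_norm A (X (T x)))\<^sup>2) + cmod (A_inner A (X (T (T x))) x)"
      using Bombieri_two[of x "T x" "X (T x)"] x by simp
    also have "\<dots> \<le> max (N\<^sup>2) (N ^ 4) + A_numerical_radius A (X \<circ> T \<circ> T)"
      using a b radius[OF x] by (intro add_mono max.mono) auto
    finally show "(cmod (A_inner A (T x) x))\<^sup>2 + A_norm A (T x) ^ 4
        \<le> max (N\<^sup>2) (N ^ 4) + A_numerical_radius A (X \<circ> T \<circ> T)" .
  qed
  then show ?thesis
    unfolding A_Davis_Wielandt_radius_def N_def[symmetric] X_def[symmetric]
    using \<open>A_norm A e = 1\<close> by (intro cSup_least) auto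
qed

end
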